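(* Let $$f_{s,t}(x)=\mathrm{cosb}_s(x)+\int_0^x \mathrm{cosb}_t(y)\,dy=\sum_{k\ge0}a_k\frac{x^k}{k!},$$ and for $n\ge1$ put $\bar n=\lceil n/2\rceil$, $\underline n=\lfloor n/2\rfloor$. Then, as an identity of rational functions of $(s,t)$, $$\det(a_{2i+j})_{0\le i,j\le n-1} =(-1)^{\binom{\bar n}2}\, \frac{\prod_{i=0}^{n-1}(2i)!}{2^{\,n(n-1)}}\, \Bigl(\prod_{l=0}^{\bar n-1}\frac{(s+\tfrac12)_l}{(s+1)_{n-1+l}}\Bigr) \Bigl(\prod_{m=0}^{\underline n-1}\frac{(t+\tfrac12)_m}{(t+1)_{n-1+m}}\Bigr) \prod_{r=1}^{\bar n}\prod_{c=1}^{\underline n}\frac{t-s+c-r}{n-r-c+1}\,.$$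
   Context: $\mathrm{cosb}_s$ is the normalised Bessel function $\mathrm{cosb}_s(x)=\Gamma(s+1)(2/x)^sJ_s(x)=\sum_{k\ge0}\frac{(-1)^k}{4^k\,k!\,(s+1)_k}x^{2k}$, viewed as a power series in $x$ with coefficients in $\mathbb Q(s)$; consequently $a_{2k}=(-1)^k(\tfrac12)_k/(s+1)_k$ and $a_{2k+1}=(-1)^k(\tfrac12)_k/(t+1)_k$. $(\gamma)_m=\gamma(\gamma+1)\cdots(\gamma+m-1)$ is the Pochhammer symbol; empty products equal $1$. *)

theory Defs
  imports
    "HOL-Computational_Algebra.Computational_Algebra"
    "Jordan_Normal_Form.Determinant"
begin

(* The field Q(s,t), as the fraction field of Q[s][t]. *)
type_synonym ratfun = "rat poly poly fract"

definition var_s :: ratfun where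
  "var_s = to_fract [: [:0, 1:] :]"

definition var_t :: ratfun where
  "var_t = to_fract [: 0, 1 :]"

(* The power series of Gamma (s + 1) * (2 / x) ^ s * J_s x, where J_s is the Bessel
   function of the first kind. *)
definition cosb :: "'a \<Rightarrow> 'a :: field_char_0 fps" where
  "cosb s = Abs_fps (\<lambda>n. if even n
     then (-1) ^ (n div 2) / (4 ^ (n div 2) * fact (n div 2) * pochhammer (s + 1) (n div 2))
     else 0)"

definition f_ser :: "'a \<Rightarrow> 'a \<Rightarrow> 'a :: field_char_0 fps" where
  "f_ser s t = cosb s + fps_integral0 (cosb t)"

(* f_ser s t is the exponential generating function of the sequence a_coeff s t. *)
definition a_coeff :: "'a \<Rightarrow> 'a \<Rightarrow> nat \<Rightarrow> 'a :: field_char_0" where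
  "a_coeff s t k = fact k * fps_nth (f_ser s t) k"

end

theory Submission
  imports Defs
begin

text \<open>
  Up to sign, the even and odd columns of the matrix consist of moments of the Beta densities
  proportional to $x^{-1/2}(1-x)^{s-1/2}$ and $x^{-1/2}(1-x)^{t-1/2}$. Column operations replace
  the test functions $x^c$ by $(1-x)^c$, which turns the entry of row $i$ into a row factor times
  a column factor times $1/(\alpha_j+1)_i$, where $\alpha_j$ is $s + c$ or $t + c$ with
  $c = \lfloor j/2\rfloor$. Clearing the denominator $(\alpha_j+1)_{n-1}$ of each column leaves
  monic polynomials of degree $n-1-i$ in $\alpha_j$, so the determinant is a Vandermonde
  determinant in the $\alpha_j$, which splits into two factorial blocks and the cross terms
  $t - s + c - r$.
\<close>

section \<open>Determinants: row and column scaling, and values of monic polynomials\<close>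

lemma det_scale_rows_cols:
  fixes A :: "nat \<Rightarrow> nat \<Rightarrow> 'a :: comm_ring_1"
  shows "det (mat n n (\<lambda>(i, j). r i * q j * A i j)) =
    (\<Prod>i<n. r i) * (\<Prod>j<n. q j) * det (mat n n (\<lambda>(i, j). A i j))"
proof -
  have "(\<Prod>i = 0..<n. r i * q (p i) * A i (p i)) =
      (\<Prod>i<n. r i) * (\<Prod>j<n. q j) * (\<Prod>i = 0..<n. A i (p i))"
    if p: "p permutes {0..<n}" for p
  proof -
    have "(\<Prod>i = 0..<n. q (p i)) = (\<Prod>j = 0..<n. q j)"
      using prod.permute[OF p, of q] by (simp add: o_def)
    then show ?thesis
      by (simp add: prod.distrib lessThan_atLeast0)
  qed
  moreover have "(\<Prod>i = 0..<n. mat n n (\<lambda>(i, j). F i j) $$ (i, p i)) = (\<Prod>i = 0..<n. F i (p i))"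
    if p: "p permutes {0..<n}" for p and F :: "nat \<Rightarrow> nat \<Rightarrow> 'a"
    using permutes_in_image[OF p] by (intro prod.cong) auto
  ultimately show ?thesis
    by (simp add: det_def sum_distrib_left mult_ac)
qed

lemma linear_factors_prod:
  fixes b :: "nat \<Rightarrow> 'a :: idom"
  shows "degree (\<Prod>l\<in>S. [:b l, 1:]) = card S" "lead_coeff (\<Prod>l\<in>S. [:b l, 1:]) = 1"
  by (subst degree_prod_eq_sum_degree; simp) (simp add: lead_coeff_prod)

text \<open>The products over \<open>k < l < n\<close> are Newton basis polynomials of degree
  \<open>n - 1 - k\<close>. Counting degrees downwards makes the coefficient matrix in
  \<open>det_monic_polys\<close> upper triangular, and the tracked coefficient
  \<open>c (n - 1 - m)\<close> becomes its diagonal entry.\<close>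

lemma newton_expansion:
  fixes p :: "'a :: idom poly" and x :: "nat \<Rightarrow> 'a"
  assumes "degree p \<le> m" "m < n"
  shows "\<exists>c. c (n - 1 - m) = coeff p m \<and>
    (\<forall>y. poly p y = (\<Sum>k\<in>{n - 1 - m..<n}. c k * (\<Prod>l\<in>{k<..<n}. y - x l)))"
  using assms
proof (induction m arbitrary: p)
  case 0
  then obtain a where "p = [:a:]"
    by (auto elim: degree_eq_zeroE)
  moreover from 0 have "{n - 1..<n} = {n - 1}" "{n - 1<..<n} = {}" by auto
  ultimately show ?case by (intro exI[of _ "\<lambda>_. a"]) simp
next
  case (Suc m)
  \<comment> \<open>\<open>N\<close> is the monic basis polynomial of degree \<open>Suc m\<close>;
    subtracting the right multiple of it cancels the top coefficient of \<open>p\<close>.\<close>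
  define N where "N = (\<Prod>l\<in>{n - 1 - Suc m<..<n}. [:- x l, 1:])"
  define q where "q = p - Polynomial.smult (coeff p (Suc m)) N"
  have N: "degree N = Suc m" "coeff N (Suc m) = 1"
    using linear_factors_prod[of "\<lambda>l. - x l" "{n - 1 - Suc m<..<n}"] Suc.prems
    by (simp_all add: N_def)
  have "degree q \<le> m"
  proof (rule degree_le, intro allI impI)
    fix i assume "m < i"
    then consider "i = Suc m" | "Suc m < i" by linarith
    then show "coeff q i = 0"
      by cases (use N Suc.prems in \<open>auto simp: q_def coeff_eq_0\<close>)
  qed
  with Suc obtain c where c: "\<And>y. poly q y = (\<Sum>k\<in>{n - 1 - m..<n}. c k * (\<Prod>l\<in>{k<..<n}. y - x l))"
    by fastforce
  have split: "{n - 1 - Suc m..<n} = insert (n - 1 - Suc m) {n - 1 - m..<n}"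
    using Suc.prems by auto
  have "poly p y = (\<Sum>k\<in>{n - 1 - Suc m..<n}.
      (c(n - 1 - Suc m := coeff p (Suc m))) k * (\<Prod>l\<in>{k<..<n}. y - x l))" for y
  proof -
    have "poly p y = coeff p (Suc m) * poly N y + poly q y"
      by (simp add: q_def)
    moreover have "poly N y = (\<Prod>l\<in>{n - 1 - Suc m<..<n}. y - x l)"
      by (simp add: N_def poly_prod)
    moreover have "n - 1 - Suc m \<notin> {n - 1 - m..<n}"
      using Suc.prems by auto
    ultimately show ?thesis
      unfolding split c by (subst sum.insert) (auto intro!: sum.cong)
  qed
  then show ?case by (intro exI[of _ "c(n - 1 - Suc m := coeff p (Suc m))"]) simp
qed

text \<open>Expanding each row polynomial in the Newton basis at the nodes factors the matrix as
  \<open>U * L\<close>: coefficients times basis values. Monicity makes \<open>U\<close>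
  unitriangular, so the diagonal of \<open>L\<close> alone gives the Vandermonde product.\<close>

lemma det_monic_polys:
  fixes p :: "nat \<Rightarrow> 'a :: idom poly" and x :: "nat \<Rightarrow> 'a"
  assumes deg: "\<And>i. i < n \<Longrightarrow> degree (p i) = n - 1 - i"
    and monic: "\<And>i. i < n \<Longrightarrow> lead_coeff (p i) = 1"
  shows "det (mat n n (\<lambda>(i, j). poly (p i) (x j))) = (\<Prod>i<n. \<Prod>l\<in>{i<..<n}. x i - x l)"
proof -
  have "\<exists>c. c i = 1 \<and> (\<forall>y. poly (p i) y = (\<Sum>k\<in>{i..<n}. c k * (\<Prod>l\<in>{k<..<n}. y - x l)))"
    if "i < n" for i
    using newton_expansion[of "p i" "n - 1 - i" n x] deg[OF that] monic[OF that] that by simp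
  then obtain c where c1: "\<And>i. i < n \<Longrightarrow> c i i = 1"
    and c: "\<And>i y. i < n \<Longrightarrow> poly (p i) y = (\<Sum>k\<in>{i..<n}. c i k * (\<Prod>l\<in>{k<..<n}. y - x l))"
    by metis
  define U where "U = mat n n (\<lambda>(i, k). if i \<le> k then c i k else 0)"
  \<comment> \<open>For \<open>k < j < n\<close> the entry contains the factor with
    \<open>l = j\<close>, which is zero; hence \<open>L\<close> is lower triangular.\<close>
  define L where "L = mat n n (\<lambda>(k, j). \<Prod>l\<in>{k<..<n}. x j - x l)"
  have carrier: "U \<in> carrier_mat n n" "L \<in> carrier_mat n n"
    by (simp_all add: U_def L_def)
  have "mat n n (\<lambda>(i, j). poly (p i) (x j)) = U * L"
  proof (rule eq_matI)
    fix i j assume ij: "i < dim_row (U * L)" "j < dim_col (U * L)"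
    then have "(U * L) $$ (i, j) =
        (\<Sum>k\<in>{0..<n}. (if i \<le> k then c i k else 0) * (\<Prod>l\<in>{k<..<n}. x j - x l))"
      by (simp add: U_def L_def scalar_prod_def)
    also have "\<dots> = (\<Sum>k\<in>{i..<n}. c i k * (\<Prod>l\<in>{k<..<n}. x j - x l))"
      by (rule sum.mono_neutral_cong_right) auto
    finally show "mat n n (\<lambda>(i, j). poly (p i) (x j)) $$ (i, j) = (U * L) $$ (i, j)"
      using ij c[of i "x j"] by (simp add: U_def L_def)
  qed (simp_all add: U_def L_def)
  then have "det (mat n n (\<lambda>(i, j). poly (p i) (x j))) = det U * det L"
    using det_mult[OF carrier] by simp
  also have "det U = prod_list (diag_mat U)"
    by (rule det_upper_triangular[OF _ carrier(1)]) (auto simp: U_def)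
  also have "\<dots> = 1"
    by (simp add: prod_list_diag_prod U_def c1)
  also have "det L = prod_list (diag_mat L)"
    by (rule det_lower_triangular[OF _ carrier(2)]) (auto simp: L_def)
  also have "\<dots> = (\<Prod>i<n. \<Prod>l\<in>{i<..<n}. x i - x l)"
    by (simp add: prod_list_diag_prod L_def lessThan_atLeast0)
  finally show ?thesis by simp
qed

section \<open>Beta moments\<close>

text \<open>This is Chu-Vandermonde. With \<open>pochhammer b k / pochhammer d k\<close> read as the
  moments of a Beta distribution with parameters b and d - b, the sum is the expectation of x^i
  (1-x)^c. The induction uses (1-x)^(c+1) = (1-x)^c - x (1-x)^c, which is Pascal's rule on the
  coefficients.\<close>

lemma sum_binomial_pochhammer_quotient:
  fixes b d :: "'a :: field_char_0"
  assumes nz: "\<And>k. pochhammer d k \<noteq> 0"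
  shows "(\<Sum>k\<le>c. of_nat (c choose k) * (-1) ^ k * (pochhammer b (i + k) / pochhammer d (i + k))) =
    pochhammer b i * pochhammer (d - b) c / pochhammer d (i + c)"
proof (induction c arbitrary: i)
  case (Suc c)
  define g where "g k = pochhammer b k / pochhammer d k" for k
  define S where "S c i = (\<Sum>k\<le>c. of_nat (c choose k) * (-1) ^ k * g (i + k))" for c i
  \<comment> \<open>The last term vanishes because \<open>c choose Suc c\<close> is 0; what remains
    is \<open>S c i\<close> without its term at 0.\<close>
  have top: "(\<Sum>k\<le>c. of_nat (c choose Suc k) * (-1) ^ Suc k * g (i + Suc k)) =
      (\<Sum>k<c. of_nat (c choose Suc k) * (-1) ^ Suc k * g (i + Suc k))"
    by (rule sum.mono_neutral_right) (auto simp: not_less binomial_eq_0)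
  have "S (Suc c) i = g i + (\<Sum>k\<le>c. of_nat (Suc c choose Suc k) * (-1) ^ Suc k * g (i + Suc k))"
    unfolding S_def by (subst sum.atMost_Suc_shift) simp
  also have "\<dots> = g i + (\<Sum>k\<le>c. of_nat (c choose Suc k) * (-1) ^ Suc k * g (i + Suc k)) - S c (Suc i)"
    by (simp add: S_def algebra_simps sum.distrib sum_negf sum_subtractf)
  also have "g i + (\<Sum>k\<le>c. of_nat (c choose Suc k) * (-1) ^ Suc k * g (i + Suc k)) = S c i"
    unfolding top S_def by (cases c) (simp_all add: sum.atMost_Suc_shift lessThan_Suc_atMost del: sum.atMost_Suc)
  finally have rec: "S (Suc c) i = S c i - S c (Suc i)" .
  have "S c i = pochhammer b i * pochhammer (d - b) c / pochhammer d (i + c)" for i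
    using Suc.IH[of i] by (simp add: S_def g_def)
  \<comment> \<open>The recursion for the closed forms, with
    \<open>Z = pochhammer d (i + c)\<close>, \<open>W = d + i + c\<close> and
    \<open>B = b + i\<close>; then \<open>W - B\<close> is the new factor of
    \<open>pochhammer (d - b) (Suc c)\<close>.\<close>
  moreover have "X * Y / Z - X * B * Y / (Z * W) = X * (Y * (W - B)) / (Z * W)"
    if "Z \<noteq> 0" "W \<noteq> 0" for X Y Z W B :: 'a
    using that by (simp add: field_simps)
  moreover have "d + of_nat (i + c) \<noteq> 0" "pochhammer d (i + c) \<noteq> 0"
    using nz[of "i + c"] nz[of "Suc (i + c)"] by (simp_all add: pochhammer_Suc)
  moreover have "d - b + of_nat c = (d + of_nat (i + c)) - (b + of_nat i)" by simp
  ultimately have "S (Suc c) i = pochhammer b i * pochhammer (d - b) (Suc c) / pochhammer d (i + Suc c)"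
    unfolding rec by (simp only: pochhammer_Suc add_Suc add_Suc_right)
  then show ?case by (simp add: S_def g_def)
qed simp

section \<open>Coefficients of the series\<close>

lemma a_coeff_even:
  fixes s t :: "'a :: field_char_0"
  shows "a_coeff s t (2 * k) = (-1) ^ k * (pochhammer (1 / 2) k / pochhammer (s + 1) k)"
proof -
  have "fps_nth (fps_integral0 (cosb t)) (2 * k) = 0"
    by (cases k) (simp_all add: fps_integral_def cosb_def)
  \<comment> \<open>The duplication formula (2k)! = 2^(2k) (1/2)_k k! cancels
    \<open>4 ^ k * fact k\<close> in \<open>cosb\<close> and leaves the Pochhammer symbol at
    1/2.\<close>
  moreover have "(2::'a) ^ (2 * k) = 4 ^ k" by (simp add: power_mult)
  ultimately show ?thesis
    by (simp add: a_coeff_def f_ser_def cosb_def fact_double)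
qed

lemma a_coeff_odd:
  fixes s t :: "'a :: field_char_0"
  shows "a_coeff s t (Suc (2 * k)) = (-1) ^ k * (pochhammer (1 / 2) k / pochhammer (t + 1) k)"
proof -
  have "fps_nth (fps_integral0 (cosb t)) (Suc (2 * k)) = fps_nth (cosb t) (2 * k) / of_nat (Suc (2 * k))"
    by (simp add: fps_integral_def field_simps)
  moreover have "of_nat (Suc (2 * k)) \<noteq> (0::'a)" by (rule of_nat_neq_0)
  moreover have "(2::'a) ^ (2 * k) = 4 ^ k" by (simp add: power_mult)
  moreover have "fact (Suc (2 * k)) = of_nat (Suc (2 * k)) * (fact (2 * k) :: 'a)" by (rule fact_Suc)
  ultimately show ?thesis
    by (simp add: a_coeff_def f_ser_def cosb_def fact_double del: of_nat_Suc fact_Suc)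
qed

section \<open>Products split by parity, and the Vandermonde product of the nodes\<close>

lemma prod_even_odd_split:
  fixes f :: "nat \<Rightarrow> 'a :: comm_monoid_mult"
  shows "(\<Prod>j<n. f j) = (\<Prod>l<(n + 1) div 2. f (2 * l)) * (\<Prod>m<n div 2. f (Suc (2 * m)))"
proof (induction n)
  case (Suc n)
  then show ?case by (cases "even n") (auto elim!: evenE oddE simp: mult_ac)
qed simp

text \<open>The grid factors are the hook lengths of an a by b rectangle. When b grows by one, the
  new column c = 0 contributes (a+b)!/b! and the other columns shift back to the old grid. Since r <
  a and c < b, the natural subtraction never truncates.\<close>

lemma prod_fact_grid:
  "(\<Prod>r<a. \<Prod>c<b. of_nat (a + b - 1 - r - c) :: 'a :: field_char_0) *
    ((\<Prod>i<a. fact i) * (\<Prod>i<b. fact i)) = (\<Prod>i<a + b. fact i)"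
proof (induction b)
  case (Suc b)
  have split: "(\<Prod>r<a. \<Prod>c<Suc b. of_nat (a + Suc b - 1 - r - c) :: 'a) =
      (\<Prod>r<a. of_nat (a + b - r)) * (\<Prod>r<a. \<Prod>c<b. of_nat (a + b - 1 - r - c))"
  proof -
    have "a + Suc b - 1 - r - 0 = a + b - r" "a + Suc b - 1 - r - Suc c = a + b - 1 - r - c" for r c
      by simp_all
    then show ?thesis
      by (simp only: prod.lessThan_Suc_shift prod.distrib)
  qed
  have fact: "fact (a + b) = (\<Prod>r<a. of_nat (a + b - r) :: 'a) * fact b"
  proof (induction a)
    case (Suc a)
    then show ?case by (simp add: prod.lessThan_Suc_shift mult_ac del: prod.lessThan_Suc)
  qed simp
  moreover have "(\<Prod>i<a + Suc b. fact i) = (\<Prod>i<a + b. fact i) * (fact (a + b) :: 'a)"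
    by simp
  ultimately show ?case
    unfolding split by (simp only: prod.lessThan_Suc mult_ac fact flip: Suc.IH)
qed simp

text \<open>These are the \<alpha>_j: nodes of equal parity differ by integers, giving factorials,
  and nodes of opposite parity give the cross terms in t - s.\<close>

definition node :: "'a \<Rightarrow> 'a \<Rightarrow> nat \<Rightarrow> 'a :: field_char_0" where
  "node s t j = (if even j then s else t) + of_nat (j div 2)"

text \<open>Nodes are added one at a time. The node s + m contributes m!, a new grid row r = m and
  the sign (-1)^m, which raises the exponent from m choose 2 to m + 1 choose 2. The node t + m
  contributes m! and a new grid column c = m without a sign.\<close>

lemma vandermonde_node:
  fixes s t :: "'a :: field_char_0"
  shows "(\<Prod>k<n. \<Prod>j<k. node s t k - node s t j) =
    (-1) ^ ((n + 1) div 2 choose 2) * ((\<Prod>i<(n + 1) div 2. fact i) * (\<Prod>i<n div 2. fact i)) *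
    (\<Prod>r<(n + 1) div 2. \<Prod>c<n div 2. t - s + of_nat c - of_nat r)"
proof (induction n)
  case (Suc n)
  have fct: "(\<Prod>c<m. of_nat m - of_nat c) = (fact m :: 'a)" for m
    by (induction m) (simp_all add: prod.lessThan_Suc_shift del: prod.lessThan_Suc)
  show ?case
  proof (cases "even n")
    case True
    then obtain m where n: "n = 2 * m" by (elim evenE)
    have "(\<Prod>j<n. node s t n - node s t j) =
        (\<Prod>c<m. of_nat m - of_nat c) * (\<Prod>c<m. - (t - s + of_nat c - of_nat m))"
      unfolding prod_even_odd_split[of _ n]
      by (intro arg_cong2[where f = "(*)"] prod.cong) (auto simp: n node_def)
    also have "\<dots> = fact m * (-1) ^ m * (\<Prod>c<m. t - s + of_nat c - of_nat m)"
      by (simp only: fct prod_uminus card_lessThan mult.assoc)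
    finally have step: "(\<Prod>j<n. node s t n - node s t j) = \<dots>" .
    have "(n + 1) div 2 = m" "n div 2 = m" "(Suc n + 1) div 2 = Suc m" "Suc n div 2 = m"
      by (simp_all add: n)
    moreover have "Suc m choose 2 = m + (m choose 2)"
      by (simp add: numeral_2_eq_2)
    ultimately show ?thesis
      using Suc step by (simp add: power_add mult_ac)
  next
    case False
    then obtain m where n: "n = Suc (2 * m)" by (auto elim: oddE)
    have "(\<Prod>j<n. node s t n - node s t j) =
        (\<Prod>r<Suc m. t - s + of_nat m - of_nat r) * (\<Prod>c<m. of_nat m - of_nat c)"
      unfolding prod_even_odd_split[of _ n]
      by (intro arg_cong2[where f = "(*)"] prod.cong) (auto simp: n node_def)
    then show ?thesis
      using Suc by (simp add: n fct prod.distrib mult_ac)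
  qed
qed (simp add: numeral_2_eq_2)

text \<open>The product supplies the last n - 1 - i factors of the longer Pochhammer symbol. Thus
  clearing the common column denominator leaves a monic polynomial in u + c.\<close>

lemma pochhammer_node:
  fixes u :: "'a :: field_char_0"
  assumes "i < n"
  shows "pochhammer (u + 1) (i + c) * (\<Prod>l\<in>{i<..<n}. u + of_nat c + of_nat l) =
    pochhammer (u + 1) (n - 1 + c)"
  using assms
proof (induction n)
  case (Suc n)
  show ?case
  proof (cases "i = n")
    case True
    then have "{i<..<Suc n} = {}" by auto
    with True show ?thesis by simp
  next
    case False
    with Suc.prems have "i < n" by simp
    then have "{i<..<Suc n} = insert n {i<..<n}" by auto
    moreover have "pochhammer (u + 1) (Suc n - 1 + c) = pochhammer (u + 1) (n - 1 + c) * (u + of_nat c + of_nat n)"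
      using \<open>i < n\<close> by (cases n) (simp_all add: pochhammer_Suc add_ac)
    ultimately show ?thesis
      using Suc.IH[OF \<open>i < n\<close>] by (simp add: mult_ac)
  qed
qed simp

lemma prod_upper_triangle_swap:
  fixes f :: "nat \<Rightarrow> nat \<Rightarrow> 'a :: comm_monoid_mult"
  shows "(\<Prod>i<n. \<Prod>l\<in>{i<..<n}. f i l) = (\<Prod>k<n. \<Prod>j<k. f j k)"
proof (induction n)
  case (Suc n)
  have "(\<Prod>i<n. \<Prod>l\<in>{i<..<Suc n}. f i l) = (\<Prod>i<n. f i n * (\<Prod>l\<in>{i<..<n}. f i l))"
  proof (rule prod.cong)
    fix i assume "i \<in> {..<n}"
    then have "{i<..<Suc n} = insert n {i<..<n}" by auto
    then show "(\<Prod>l\<in>{i<..<Suc n}. f i l) = f i n * (\<Prod>l\<in>{i<..<n}. f i l)" by simp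
  qed simp
  moreover have "{n<..<Suc n} = {}" by auto
  ultimately show ?case using Suc by (simp add: prod.distrib mult_ac)
qed simp

section \<open>Reduction of the coefficient determinant to the Vandermonde product\<close>

lemma det_a_coeff_eq_vandermonde:
  fixes s t :: "'a :: field_char_0"
  assumes s: "\<And>k. pochhammer (s + 1) k \<noteq> 0" and t: "\<And>k. pochhammer (t + 1) k \<noteq> 0"
  shows "det (mat n n (\<lambda>(i, j). a_coeff s t (2 * i + j))) =
    (\<Prod>i<n. pochhammer (1 / 2) i) *
    (\<Prod>l<(n + 1) div 2. pochhammer (s + 1 / 2) l / pochhammer (s + 1) (n - 1 + l)) *
    (\<Prod>m<n div 2. pochhammer (t + 1 / 2) m / pochhammer (t + 1) (n - 1 + m)) *
    (\<Prod>k<n. \<Prod>j<k. node s t k - node s t j)"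
proof -
  define par where "par j = (if even j then s else t)" for j :: nat
  have par: "pochhammer (par j + 1) k \<noteq> 0" for j k
    using s t by (simp add: par_def)
  define M where "M = mat n n (\<lambda>(i, j). a_coeff s t (2 * i + j))"
  \<comment> \<open>Column operations within each parity class, passing from x^c to (1-x)^c. The
    binomials carry no sign because \<open>a_coeff\<close> already alternates; the unit diagonal
    gives determinant 1.\<close>
  define U where "U = mat n n (\<lambda>(k, j). if k \<le> j \<and> even (j - k)
    then of_nat (j div 2 choose (k div 2)) else 0 :: 'a)"
  define r where "r i = (-1) ^ i * pochhammer (1 / 2 :: 'a) i" for i :: nat
  define q where "q j = pochhammer (par j + 1 / 2) (j div 2) / pochhammer (par j + 1) (n - 1 + j div 2)"
    for j
  \<comment> \<open>The roots -l do not depend on the column, so both parities share the same row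
    polynomial; all parity dependence sits in \<open>q\<close> and in the node.\<close>
  define P where "P i = (\<Prod>l\<in>{i<..<n}. [:of_nat l :: 'a, 1:])" for i :: nat
  have carrier: "M \<in> carrier_mat n n" "U \<in> carrier_mat n n"
    by (simp_all add: M_def U_def)
  have a: "a_coeff s t (2 * i + (2 * l + j mod 2)) =
      (-1) ^ i * ((-1) ^ l * (pochhammer (1 / 2) (i + l) / pochhammer (par j + 1) (i + l)))" for i l j
    using a_coeff_even[of s t "i + l"] a_coeff_odd[of s t "i + l"]
    by (cases "even j") (simp_all add: par_def power_add mod2_eq_if)
  have "M * U = mat n n (\<lambda>(i, j). r i * q j * poly (P i) (node s t j))"
  proof (rule eq_matI)
    fix i j
    assume "i < dim_row (mat n n (\<lambda>(i, j). r i * q j * poly (P i) (node s t j)))"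
      and "j < dim_col (mat n n (\<lambda>(i, j). r i * q j * poly (P i) (node s t j)))"
    then have ij: "i < n" "j < n" by simp_all
    define c where "c = j div 2"
    have j: "j = 2 * c + j mod 2" by (simp add: c_def)
    have "(M * U) $$ (i, j) = (\<Sum>k\<in>{0..<n}. a_coeff s t (2 * i + k) *
        (if k \<le> j \<and> even (j - k) then of_nat (c choose (k div 2)) else 0))"
      using ij unfolding c_def by (simp add: M_def U_def scalar_prod_def)
    \<comment> \<open>Only columns \<open>k \<le> j\<close> of the parity of \<open>j\<close>
      survive; these are \<open>2 * l + j mod 2\<close> with \<open>l \<le> c\<close>.\<close>
    also have "\<dots> = (\<Sum>k\<in>(\<lambda>l. 2 * l + j mod 2) ` {..c}.
        a_coeff s t (2 * i + k) * of_nat (c choose (k div 2)))"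
    proof (rule sum.mono_neutral_cong_right)
      show "(\<lambda>l. 2 * l + j mod 2) ` {..c} \<subseteq> {0..<n}"
      proof
        fix k assume "k \<in> (\<lambda>l. 2 * l + j mod 2) ` {..c}"
        then have "k \<le> j" using j by auto
        with ij show "k \<in> {0..<n}" by simp
      qed
      show "\<forall>k\<in>{0..<n} - (\<lambda>l. 2 * l + j mod 2) ` {..c}. a_coeff s t (2 * i + k) *
          (if k \<le> j \<and> even (j - k) then of_nat (c choose (k div 2)) else 0) = 0"
      proof
        fix k assume k: "k \<in> {0..<n} - (\<lambda>l. 2 * l + j mod 2) ` {..c}"
        have False if "k \<le> j" "even (j - k)"
        proof -
          have "k = 2 * (k div 2) + j mod 2" using that by presburger
          moreover have "k div 2 \<le> c" using that by (simp add: c_def div_le_mono)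
          ultimately show False using k by blast
        qed
        then show "a_coeff s t (2 * i + k) *
          (if k \<le> j \<and> even (j - k) then of_nat (c choose (k div 2)) else 0) = 0" by auto
      qed
    next
      fix k assume "k \<in> (\<lambda>l. 2 * l + j mod 2) ` {..c}"
      then obtain l where l: "k = 2 * l + j mod 2" "l \<le> c" by auto
      then have "k \<le> j" using j by linarith
      moreover have "even (j - k)"
      proof -
        have "j - k = 2 * (c - l)" using j l by linarith
        then show ?thesis by simp
      qed
      ultimately show "a_coeff s t (2 * i + k) *
          (if k \<le> j \<and> even (j - k) then of_nat (c choose (k div 2)) else 0) =
          a_coeff s t (2 * i + k) * of_nat (c choose (k div 2))" by simp
    qed simp
    also have "\<dots> = (\<Sum>l\<le>c. a_coeff s t (2 * i + (2 * l + j mod 2)) * of_nat (c choose l))"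
      by (subst sum.reindex) (auto simp: inj_on_def)
    also have "\<dots> = (-1) ^ i * (\<Sum>l\<le>c. of_nat (c choose l) * (-1) ^ l *
        (pochhammer (1 / 2) (i + l) / pochhammer (par j + 1) (i + l)))"
      unfolding a by (simp add: sum_distrib_left mult_ac)
    \<comment> \<open>The Beta sum with b = 1/2 and d = \<open>par j + 1\<close>; the difference d -
      b is the source of s + 1/2 and t + 1/2.\<close>
    also have "\<dots> = r i * (pochhammer (par j + 1 / 2) c / pochhammer (par j + 1) (i + c))"
      by (subst sum_binomial_pochhammer_quotient[OF par]) (simp add: r_def add.commute)
    also have "\<dots> = r i * q j * poly (P i) (node s t j)"
    proof -
      have "poly (P i) (node s t j) = (\<Prod>l\<in>{i<..<n}. par j + of_nat c + of_nat l)"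
        by (simp add: P_def poly_prod node_def par_def c_def add_ac)
      then have "pochhammer (par j + 1) (i + c) * poly (P i) (node s t j) = pochhammer (par j + 1) (n - 1 + c)"
        using pochhammer_node[OF ij(1), of "par j" c] by simp
      then show ?thesis
        using par[of j "i + c"] par[of j "n - 1 + c"] by (simp add: q_def c_def field_simps)
    qed
    finally show "(M * U) $$ (i, j) =
        mat n n (\<lambda>(i, j). r i * q j * poly (P i) (node s t j)) $$ (i, j)"
      using ij by simp
  qed (simp_all add: M_def U_def)
  moreover have "det U = 1"
    using det_upper_triangular[OF _ carrier(2)]
    by (simp add: prod_list_diag_prod upper_triangular_def U_def)
  ultimately have "det M = det (mat n n (\<lambda>(i, j). r i * q j * poly (P i) (node s t j)))"
    using det_mult[OF carrier] by simp
  also have "\<dots> = (\<Prod>i<n. r i) * (\<Prod>j<n. q j) * det (mat n n (\<lambda>(i, j). poly (P i) (node s t j)))"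
    by (rule det_scale_rows_cols)
  also have "det (mat n n (\<lambda>(i, j). poly (P i) (node s t j))) =
      (\<Prod>i<n. \<Prod>l\<in>{i<..<n}. node s t i - node s t l)"
  proof (rule det_monic_polys)
    show "degree (P i) = n - 1 - i" for i
      by (simp add: P_def linear_factors_prod)
    show "lead_coeff (P i) = 1" for i
      unfolding P_def by (rule linear_factors_prod)
  qed
  \<comment> \<open>Reversing every difference costs (-1)^k for each k, which cancels against the
    row signs in \<open>r\<close>.\<close>
  also have "\<dots> = (\<Prod>k<n. \<Prod>j<k. - (node s t k - node s t j))"
    by (simp add: prod_upper_triangle_swap)
  also have "\<dots> = (\<Prod>k<n. (-1) ^ k) * (\<Prod>k<n. \<Prod>j<k. node s t k - node s t j)"
    by (simp only: prod_uminus card_lessThan prod.distrib)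
  also have "(\<Prod>i<n. r i) = (\<Prod>k<n. (-1) ^ k) * (\<Prod>i<n. pochhammer (1 / 2) i)"
    by (simp add: r_def prod.distrib)
  also have "(\<Prod>j<n. q j) =
      (\<Prod>l<(n + 1) div 2. pochhammer (s + 1 / 2) l / pochhammer (s + 1) (n - 1 + l)) *
      (\<Prod>m<n div 2. pochhammer (t + 1 / 2) m / pochhammer (t + 1) (n - 1 + m))"
    unfolding prod_even_odd_split[of q] by (simp add: q_def par_def)
  finally have "det M = ((\<Prod>k<n. (-1) ^ k) * (\<Prod>k<n. (-1) ^ k)) * ((\<Prod>i<n. pochhammer (1 / 2) i) *
    (\<Prod>l<(n + 1) div 2. pochhammer (s + 1 / 2) l / pochhammer (s + 1) (n - 1 + l)) *
    (\<Prod>m<n div 2. pochhammer (t + 1 / 2) m / pochhammer (t + 1) (n - 1 + m)) *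
    (\<Prod>k<n. \<Prod>j<k. node s t k - node s t j))"
    by (simp only: mult_ac)
  moreover have "(\<Prod>k<n. (-1) ^ k) * (\<Prod>k<n. (-1) ^ k) = (1 :: 'a)"
    by (simp flip: prod.distrib power_add)
  ultimately show ?thesis by (simp add: M_def)
qed

section \<open>Assembling the closed form over the rational function field\<close>

lemma prod_pochhammer_half:
  "(\<Prod>i<n. pochhammer (1 / 2) i) * (\<Prod>i<n. fact i) =
    (\<Prod>i<n. fact (2 * i) :: 'a :: field_char_0) / 2 ^ (n * (n - 1))"
proof -
  \<comment> \<open>The powers of two come from the duplication formula; their exponents 2i sum to
    n(n-1).\<close>
  have "(\<Prod>i<n. 2 ^ (2 * i)) = (2 :: 'a) ^ (n * (n - 1))"
  proof (induction n)
    case (Suc n)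
    have "Suc n * (Suc n - 1) = n * (n - 1) + 2 * n" by (cases n) simp_all
    with Suc show ?case by (simp only: prod.lessThan_Suc power_add)
  qed simp
  then show ?thesis
    by (simp add: fact_double prod.distrib)
qed

text \<open>The factorial quotient is the reciprocal of the hook product of
  \<open>prod_fact_grid\<close>. Shifting both indices by one fixes c - r and turns the denominator
  n - r - c + 1 into a + b - 1 - r - c.\<close>

lemma prod_rational_grid:
  fixes u :: "'a :: field_char_0"
  assumes n: "n = a + b"
  shows "(\<Prod>r<a. \<Prod>c<b. u + of_nat c - of_nat r) * ((\<Prod>i<a. fact i) * (\<Prod>i<b. fact i)) / (\<Prod>i<n. fact i) =
    (\<Prod>r = 1..a. \<Prod>c = 1..b. (u + of_nat c - of_nat r) / (of_nat n - of_nat r - of_nat c + 1))"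
proof -
  define D where "D = (\<Prod>r<a. \<Prod>c<b. of_nat (a + b - 1 - r - c) :: 'a)"
  have "(\<Prod>r = 1..a. \<Prod>c = 1..b. (u + of_nat c - of_nat r) / (of_nat n - of_nat r - of_nat c + 1)) =
      (\<Prod>r<a. \<Prod>c<b. (u + of_nat c - of_nat r) / of_nat (a + b - 1 - r - c))"
    unfolding One_nat_def prod.atLeast1_atMost_eq
    by (intro prod.cong refl) (simp add: n of_nat_diff algebra_simps)
  also have "\<dots> = (\<Prod>r<a. \<Prod>c<b. u + of_nat c - of_nat r) / D"
    by (simp only: prod_dividef D_def)
  also have "D = (\<Prod>i<n. fact i) / ((\<Prod>i<a. fact i) * (\<Prod>i<b. fact i))"
    using prod_fact_grid[of a b, where 'a = 'a] by (simp add: D_def n field_simps)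
  finally show ?thesis by simp
qed

text \<open>Each factor is the image of a nonzero polynomial under the injective embedding into the
  fraction field. This supplies the nonvanishing denominators when the field identity is specialised
  to the variables s and t.\<close>

lemma pochhammer_ratfun_neq_0:
  assumes "\<And>k. p + of_nat (Suc k) \<noteq> 0"
  shows "pochhammer (to_fract p + 1 :: ratfun) m \<noteq> 0"
proof -
  have of_nat: "to_fract (of_nat k :: rat poly poly) = of_nat k" for k
    by (induction k) simp_all
  have "to_fract p + 1 + of_nat k = to_fract (p + of_nat (Suc k))" for k
    by (simp only: to_fract_add of_nat) simp
  then have "to_fract p + 1 + of_nat k \<noteq> 0" for k
    using assms[of k] by (simp only: to_fract_eq_0_iff not_False_eq_True)
  then show ?thesis
    by (simp add: pochhammer_prod)
qed

theorem theorem23p1: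
  fixes n nu nd :: nat and s t :: ratfun
  defines "s \<equiv> var_s" and "t \<equiv> var_t"
    and "nu \<equiv> nat \<lceil>real n / 2\<rceil>" and "nd \<equiv> nat \<lfloor>real n / 2\<rfloor>"
  assumes "n \<ge> 1"
  shows "det (mat n n (\<lambda>(i, j). a_coeff s t (2 * i + j))) =
    (-1) ^ (nu choose 2)
    * ((\<Prod>i = 0..n - 1. fact (2 * i)) / 2 ^ (n * (n - 1)))
    * (\<Prod>l<nu. pochhammer (s + 1 / 2) l / pochhammer (s + 1) (n - 1 + l))
    * (\<Prod>m<nd. pochhammer (t + 1 / 2) m / pochhammer (t + 1) (n - 1 + m))
    * (\<Prod>r = 1..nu. \<Prod>c = 1..nd.
        (t - s + of_nat c - of_nat r) / (of_nat n - of_nat r - of_nat c + 1))"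
proof -
  have nu: "(n + 1) div 2 = nu" and nd: "n div 2 = nd"
    unfolding nu_def nd_def by linarith+
  then have sum: "n = nu + nd" by linarith
  have "pochhammer (s + 1) k \<noteq> 0" "pochhammer (t + 1) k \<noteq> 0" for k
    unfolding s_def var_s_def t_def var_t_def
    by (rule pochhammer_ratfun_neq_0; simp add: of_nat_poly del: of_nat_Suc)+
  note det = det_a_coeff_eq_vandermonde[OF this, of n, unfolded vandermonde_node nu nd]
  have "{0..n - 1} = {..<n}" using \<open>n \<ge> 1\<close> by auto
  \<comment> \<open>The division by the product of i! is what combines with the two Vandermonde
    factorial blocks into the grid denominators.\<close>
  moreover have "(\<Prod>i<n. pochhammer (1 / 2) i) =
      (\<Prod>i<n. fact (2 * i) :: ratfun) / 2 ^ (n * (n - 1)) / (\<Prod>i<n. fact i)"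
    unfolding prod_pochhammer_half[symmetric] by simp
  ultimately show ?thesis
    unfolding prod_rational_grid[OF sum, symmetric]
    by (simp add: det)
qed

end
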